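(* Given a string $x$ of length $n$, one can determine, for every integer $k'$ with $1 \leq k' \leq n$, whether $x$ is $k'$-cyclic coverable, in $\mathcal{O}(n^2)$ total time and $\mathcal{O}(n)$ space.
   Context: For a string $u=u_1u_2\cdots u_k$ and $1\le \delta\le k$, the rotation $c_\delta(u)$ is $u_\delta\cdots u_k u_1\cdots u_{\delta-1}$; we write $v=c(u)$ if $v=c_\delta(u)$ for some $\delta$ (i.e. $v$ is a cyclic rotation of $u$). For a string $x=x[1]\cdots x[n]$, $x[\beta..\gamma]$ denotes the substring $x[\beta]x[\beta+1]\cdots x[\gamma]$. A string $x$ of length $n$ is cyclic-coverable by a string $u$ of length $k'$ if for every position $i$, $1\le i\le n$, there exist $\beta\le i\le\gamma$ with $1\le\beta$, $\gamma\le n$, such that $x[\beta..\gamma]=c(u)$. The string $x$ is $k'$-cyclic coverable if it is cyclic-coverable by some string $u$ of length $k'$. *)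

theory Defs
  imports Complex_Main "HOL-Library.Landau_Symbols"
begin

section \<open>Cyclic covers\<close>

text \<open>Strings are lists. Positions in the definitions of this section are 1-based, whereas
  list indexing with \<open>!\<close> is 0-based.\<close>

text \<open>For \<open>1 \<le> \<delta> \<le> length u\<close>, the string \<open>c\<^sub>\<delta>(u) = u\<^sub>\<delta> \<dots> u\<^sub>k u\<^sub>1 \<dots> u\<^bsub>\<delta>-1\<^esub>\<close> is
  \<open>u\<close> rotated to the left by \<open>\<delta> - 1\<close>.\<close>

definition is_rotation :: "'a list \<Rightarrow> 'a list \<Rightarrow> bool" where
  "is_rotation v u \<longleftrightarrow> (\<exists>\<delta>. 1 \<le> \<delta> \<and> \<delta> \<le> length u \<and> v = rotate (\<delta> - 1) u)"

definition substring :: "'a list \<Rightarrow> nat \<Rightarrow> nat \<Rightarrow> 'a list" where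
  "substring x \<beta> \<gamma> = take (Suc \<gamma> - \<beta>) (drop (\<beta> - 1) x)"

definition cyclic_coverable_by :: "'a list \<Rightarrow> 'a list \<Rightarrow> bool" where
  "cyclic_coverable_by x u \<longleftrightarrow>
     (\<forall>i. 1 \<le> i \<and> i \<le> length x \<longrightarrow>
        (\<exists>\<beta> \<gamma>. 1 \<le> \<beta> \<and> \<beta> \<le> i \<and> i \<le> \<gamma> \<and> \<gamma> \<le> length x \<and>
               is_rotation (substring x \<beta> \<gamma>) u))"

definition cyclic_coverable :: "nat \<Rightarrow> 'a list \<Rightarrow> bool" where
  "cyclic_coverable k x \<longleftrightarrow> (\<exists>u. length u = k \<and> cyclic_coverable_by x u)"

section \<open>Word RAM\<close>

text \<open>
  A unit-cost word RAM. A program is a finite list of instructions, hence uses a constant number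
  of registers; besides these it has a memory of \<open>S\<close> words. Registers and memory cells hold
  natural numbers below \<open>2 ^ w\<close>, where \<open>w\<close> is the word length. An instruction that would
  produce a larger number, or that accesses a non-existing memory cell or input position, faults:
  the computation is stuck and never halts. The program itself has no access to \<open>S\<close> and \<open>w\<close>.

  The input string is read-only and its letters are opaque: nothing is assumed about the alphabet,
  and the only operation on letters is the test whether two (0-based) input positions hold the
  same letter.
\<close>

type_synonym reg = nat

datatype instr =
    Const reg nat            (* r := v *)
  | Add reg reg reg          (* r := a + b *)
  | Sub reg reg reg          (* r := a - b, truncated at 0 *)
  | Mul reg reg reg          (* r := a * b *)
  | Div reg reg reg          (* r := a div b *)
  | Load reg reg             (* r := mem[a] *)
  | Store reg reg            (* mem[a] := r, address register first *)
  | Jump nat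
  | JumpLess reg reg nat     (* jump if a < b *)
  | JumpSame reg reg nat     (* jump if the letters at input positions a and b are equal *)

type_synonym program = "instr list"

text \<open>Program counter, registers, memory.\<close>

type_synonym config = "nat \<times> (reg \<Rightarrow> nat) \<times> nat list"

fun set_reg :: "nat \<Rightarrow> reg \<Rightarrow> nat \<Rightarrow> config \<Rightarrow> config option" where
  "set_reg w r v (pc, R, M) = (if v < 2 ^ w then Some (Suc pc, R(r := v), M) else None)"

fun exec :: "nat \<Rightarrow> 'a list \<Rightarrow> instr \<Rightarrow> config \<Rightarrow> config option" where
  "exec w x (Const r v) (pc, R, M) = set_reg w r v (pc, R, M)"
| "exec w x (Add r a b) (pc, R, M) = set_reg w r (R a + R b) (pc, R, M)"
| "exec w x (Sub r a b) (pc, R, M) = set_reg w r (R a - R b) (pc, R, M)"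
| "exec w x (Mul r a b) (pc, R, M) = set_reg w r (R a * R b) (pc, R, M)"
| "exec w x (Div r a b) (pc, R, M) = set_reg w r (R a div R b) (pc, R, M)"
| "exec w x (Load r a) (pc, R, M) =
     (if R a < length M then set_reg w r (M ! R a) (pc, R, M) else None)"
| "exec w x (Store a r) (pc, R, M) =
     (if R a < length M then Some (Suc pc, R, M[R a := R r]) else None)"
| "exec w x (Jump l) (pc, R, M) = Some (l, R, M)"
| "exec w x (JumpLess a b l) (pc, R, M) = Some (if R a < R b then l else Suc pc, R, M)"
| "exec w x (JumpSame a b l) (pc, R, M) =
     (if R a < length x \<and> R b < length x
      then Some (if x ! R a = x ! R b then l else Suc pc, R, M) else None)"

definition step :: "nat \<Rightarrow> program \<Rightarrow> 'a list \<Rightarrow> config \<Rightarrow> config option" where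
  "step w P x c = (if fst c < length P then exec w x (P ! fst c) c else None)"

fun run :: "nat \<Rightarrow> program \<Rightarrow> 'a list \<Rightarrow> nat \<Rightarrow> config \<Rightarrow> config option" where
  "run w P x 0 c = Some c"
| "run w P x (Suc t) c = Option.bind (step w P x c) (run w P x t)"

text \<open>Register 0 initially holds the length of the input, all other registers and the memory
  hold 0. The program halts when the program counter reaches the end of the program.\<close>

definition init :: "nat \<Rightarrow> 'a list \<Rightarrow> config" where
  "init S x = (0, (\<lambda>_. 0)(0 := length x), replicate S 0)"

text \<open>With \<open>S\<close> memory cells and word length \<open>w\<close>, the program \<open>P\<close> on input \<open>x\<close> halts after
  exactly \<open>t\<close> steps with final memory \<open>M\<close>.\<close>

definition halts_with :: "nat \<Rightarrow> nat \<Rightarrow> program \<Rightarrow> 'a list \<Rightarrow> nat \<Rightarrow> nat list \<Rightarrow> bool" where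
  "halts_with S w P x t M \<longleftrightarrow>
     length x < 2 ^ w \<and> (\<exists>R. run w P x t (init S x) = Some (length P, R, M))"

end

theory Submission
  imports Defs "HOL-Library.Sublist"
begin

text \<open>
  Position 1 can only be covered by a prefix of \<open>x\<close>, so it suffices to know, for all \<open>j\<close> and \<open>k\<close>,
  whether the window of length \<open>k\<close> at the 0-based position \<open>j\<close> is a rotation of the prefix of
  length \<open>k\<close>. Let \<open>D\<close> be minimal such that the prefix without its first \<open>D\<close> letters is a prefix of
  the window, and \<open>m\<close> minimal such that the window without its first \<open>m\<close> letters is a prefix of
  \<open>x\<close>. A combinatorial argument shows that the window is a rotation iff one of these two extremal
  splits witnesses it. For fixed \<open>j\<close> both \<open>D\<close> and \<open>m\<close> are monotone in \<open>k\<close>, so two pointers find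
  them for all \<open>k\<close> in linear time, given the lengths of the longest common extensions of \<open>(d, j)\<close>
  for all \<open>d\<close> and of \<open>(p, 0)\<close> for all \<open>p \<ge> j\<close>. Treating \<open>j\<close> in decreasing order, the former are
  updated in place in linear time, and the value for \<open>d = 0\<close> extends the latter. For each \<open>k\<close> the
  windows found extend greedily the suffix of \<open>x\<close> that is covered so far.
\<close>

subsection \<open>Rotations\<close>

text \<open>As long as \<open>y\<close> and \<open>z\<close> are no shorter than \<open>f\<close>,
  both begin with \<open>f\<close>, which can be stripped; after that both are the prefix of
  \<open>f\<close> of their common length.\<close>

lemma conjugator_unique:
  assumes "f @ y = y @ e" "f @ z = z @ e" "length y = length z" "f \<noteq> []"
  shows "y = z"
  using assms
proof (induction "length y" arbitrary: y z rule: less_induct)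
  case less
  show ?case
  proof (cases "length f \<le> length y")
    case True
    have "take (length f) y = f" "take (length f) z = f"
      using True less.prems(3) arg_cong[OF less.prems(1), of "take (length f)"]
        arg_cong[OF less.prems(2), of "take (length f)"] by simp_all
    then obtain y' z' where "y = f @ y'" "z = f @ z'"
      by (metis append_take_drop_id)
    moreover have "y' = z'"
    proof (rule less.hyps)
      show "length y' < length y" using calculation less.prems(4) by simp
      show "f @ y' = y' @ e" "f @ z' = z' @ e" "length y' = length z'"
        using less.prems(1-3) calculation by (metis append_assoc same_append_eq,
          metis append_assoc same_append_eq, simp)
    qed (rule less.prems(4))
    ultimately show ?thesis by simp
  next
    case False
    then show ?thesis using less.prems
      by (metis append_eq_append_conv_if nat_le_linear)
  qed
qed

text \<open>Both \<open>f\<close> and \<open>h\<close>, and \<open>e\<close> and \<open>g\<close>, commute. Hence \<open>b\<^sub>2\<close> and \<open>b\<^sub>3\<close>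
  solve the same conjugacy equation \<open>f @ y = y @ e\<close>, which has one solution of each length.\<close>

lemma shared_conjugators:
  assumes "f @ b = b @ e" "g @ a = a @ h"
    and a: "a = a\<^sub>2 @ f" "a = e @ a\<^sub>3" and b: "b = b\<^sub>2 @ g" "b = h @ b\<^sub>3"
    and "length f \<le> length g" "f \<noteq> []"
  shows "b\<^sub>2 = b\<^sub>3"
proof -
  have len: "length e = length f" "length h = length g"
    using arg_cong[OF assms(1), of length] arg_cong[OF assms(2), of length] by simp_all
  \<comment> \<open>\<open>e\<close> is a prefix of \<open>a\<close> and hence of \<open>g\<close>;
    cancelling in \<open>f @ b = b @ e\<close> shows that it is a suffix of \<open>g\<close> with
    the same remainder. The claim for \<open>h\<close> and \<open>f\<close> is the mirror
    image.\<close>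
  have "e @ g = g @ e"
  proof -
    obtain g' where g': "g = e @ g'"
      using assms(2) a(2) len assms(7) by (metis append_assoc append_eq_append_conv_if append_take_drop_id)
    have "(f @ b\<^sub>2) @ g = (b\<^sub>2 @ e) @ (g' @ e)"
      using assms(1) b g' by simp
    then have "g = g' @ e" using len by (subst (asm) append_eq_append_conv) auto
    then show ?thesis using g' by (metis append_assoc)
  qed
  moreover have "h @ f = f @ h"
  proof -
    have "(g @ a\<^sub>2) @ f = (a @ take (length h - length f) h) @ drop (length h - length f) h"
      using assms(2) a(1) by simp
    then have "f = drop (length h - length f) h"
      using len assms(7) by (subst (asm) append_eq_append_conv) auto
    then obtain h' where h': "h = h' @ f"
      by (metis append_take_drop_id)
    have "(f @ h') @ (f @ b\<^sub>3) = (h' @ f) @ (b\<^sub>3 @ e)"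
      using assms(1) b h' by simp
    then have "f @ h' = h' @ f" by (subst (asm) append_eq_append_conv) auto
    then show ?thesis using h' by simp
  qed
  ultimately have "f @ b\<^sub>3 = b\<^sub>3 @ e" "f @ b\<^sub>2 = b\<^sub>2 @ e"
    using assms(1) b by (metis append.assoc same_append_eq, metis append.assoc append_same_eq)
  moreover have "length b\<^sub>3 = length b\<^sub>2" using len b by (metis add.commute add_right_cancel length_append)
  ultimately show ?thesis using conjugator_unique assms(8) by metis
qed

lemma is_rotation_iff: "is_rotation v u \<longleftrightarrow> u \<noteq> [] \<and> (\<exists>a b. u = a @ b \<and> v = b @ a)"
proof
  assume "is_rotation v u"
  then obtain d where "1 \<le> d" "d \<le> length u" "v = rotate (d - 1) u" by (auto simp: is_rotation_def)
  then show "u \<noteq> [] \<and> (\<exists>a b. u = a @ b \<and> v = b @ a)"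
    by (intro conjI exI[of _ "take (d - 1) u"] exI[of _ "drop (d - 1) u"])
       (auto simp: rotate_drop_take)
next
  assume *: "u \<noteq> [] \<and> (\<exists>a b. u = a @ b \<and> v = b @ a)"
  then obtain a b where ab: "u = a @ b" "v = b @ a" by blast
  show "is_rotation v u"
  proof (cases "b = []")
    case True
    with ab * show ?thesis unfolding is_rotation_def by (intro exI[of _ 1]) (auto simp: Suc_le_eq)
  next
    case False
    with ab show ?thesis unfolding is_rotation_def
      by (intro exI[of _ "Suc (length a)"]) (auto simp: rotate_append Suc_le_eq)
  qed
qed

lemma is_rotation_sym: "is_rotation v u \<Longrightarrow> is_rotation u v"
  unfolding is_rotation_iff by auto

lemma is_rotation_length: "is_rotation v u \<Longrightarrow> length v = length u"
  unfolding is_rotation_iff by auto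

lemma is_rotation_trans:
  assumes "is_rotation w v" "is_rotation v u" shows "is_rotation w u"
proof -
  obtain r s where "v = rotate r u" "w = rotate s v" "u \<noteq> []"
    using assms unfolding is_rotation_def by force
  then have "w = rotate ((s + r) mod length u) u" "u \<noteq> []"
    by (simp_all add: rotate_rotate rotate_conv_mod[of "s + r"])
  then show ?thesis unfolding is_rotation_def
    by (intro exI[of _ "Suc ((s + r) mod length u)"]) (auto simp: Suc_le_eq)
qed

text \<open>Write \<open>u = a @ b\<close> and \<open>v = b @ a\<close>. The split of \<open>v\<close> after the longest suffix of \<open>u\<close> that
  is a prefix of \<open>v\<close> need not witness the rotation, nor need the split of \<open>u\<close> after the longest
  suffix of \<open>v\<close> that is a prefix of \<open>u\<close>; but one of the two does.\<close>

lemma is_rotation_iff_extremal: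
  assumes k: "length u = k" "length v = k" "0 < k"
    and D: "D \<le> k" "take (k - D) v = drop D u" "\<And>d. d < D \<Longrightarrow> take (k - d) v \<noteq> drop d u"
    and m: "m \<le> k" "drop m v = take (k - m) u" "\<And>d. d < m \<Longrightarrow> drop d v \<noteq> take (k - d) u"
  shows "is_rotation v u \<longleftrightarrow> drop (k - D) v = take D u \<or> drop (k - m) u = take m v"
proof
  assume "drop (k - D) v = take D u \<or> drop (k - m) u = take m v"
  then show "is_rotation v u"
  proof
    assume "drop (k - D) v = take D u"
    then have "u = take D u @ drop D u" "v = drop D u @ take D u"
      using D(2) by (metis append_take_drop_id)+
    moreover have "u \<noteq> []" using k by auto
    ultimately show ?thesis unfolding is_rotation_iff by metis
  next
    assume "drop (k - m) u = take m v"
    then have "u = take (k - m) u @ take m v" "v = take m v @ take (k - m) u"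
      using m(2) by (metis append_take_drop_id)+
    moreover have "u \<noteq> []" using k by auto
    ultimately show ?thesis unfolding is_rotation_iff by metis
  qed
next
  assume "is_rotation v u"
  then obtain a b where ab: "u = a @ b" "v = b @ a" unfolding is_rotation_iff by blast
  have kab: "k = length a + length b" using ab k by simp
  have Da: "D \<le> length a"
    using D(3)[of "length a"] ab kab by (force simp: not_le)
  have mb: "m \<le> length b"
    using m(3)[of "length b"] ab kab by (force simp: not_le)
  \<comment> \<open>\<open>f\<close> and \<open>g\<close> measure by how much \<open>D\<close> and
    \<open>m\<close> fall short of the given split; \<open>fb\<close> and \<open>ga\<close> restate
    the two extremal matches in terms of \<open>a\<close> and \<open>b\<close>.\<close>
  define f g e h where "f = drop D a" and "g = drop m b"
    and "e = take (length a - D) a" and "h = take (length b - m) b"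
  have fb: "f @ b = b @ e" using D(2) Da kab ab unfolding f_def e_def
    by (simp)
  have ga: "g @ a = a @ h" using m(2) mb kab ab unfolding g_def h_def by simp
  have a: "a = take D a @ f" "a = e @ drop (length a - D) a"
    and b: "b = take m b @ g" "b = h @ drop (length b - m) b"
    unfolding f_def e_def g_def h_def by simp_all
  have D': "drop (k - D) v = drop (length a - D) a" "take D u = take D a"
    using ab kab Da by (simp_all)
  have m': "drop (k - m) u = drop (length b - m) b" "take m v = take m b"
    using ab kab mb by (simp_all)
  show "drop (k - D) v = take D u \<or> drop (k - m) u = take m v"
  \<comment> \<open>An empty \<open>f\<close> or \<open>g\<close> means that an extremal split is
    the given one. Otherwise the shorter of the two decides: \<open>m\<close> is a witness if it is
    \<open>f\<close>, \<open>D\<close> if it is \<open>g\<close>.\<close>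
  proof (cases "f = [] \<or> g = []")
    case True
    then show ?thesis using D' m' Da mb unfolding f_def g_def by auto
  next
    case False
    then show ?thesis using shared_conjugators[OF fb ga a b] shared_conjugators[OF ga fb b a] D' m'
      by (metis nat_le_linear)
  qed
qed

section \<open>Longest common extensions and the rotation test for windows\<close>

definition lce :: "'a list \<Rightarrow> nat \<Rightarrow> nat \<Rightarrow> nat" where
  "lce x i j = length (longest_common_prefix (drop i x) (drop j x))"

lemma le_length_longest_common_prefix_iff:
  "l \<le> length (longest_common_prefix xs ys) \<longleftrightarrow>
     l \<le> length xs \<and> l \<le> length ys \<and> take l xs = take l ys"
proof (induction xs ys arbitrary: l rule: longest_common_prefix.induct)
  case (1 x xs y ys)
  then show ?case by (cases l) auto
qed auto

lemma le_lce_iff: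
  assumes "i \<le> length x" "j \<le> length x"
  shows "l \<le> lce x i j \<longleftrightarrow>
    i + l \<le> length x \<and> j + l \<le> length x \<and> take l (drop i x) = take l (drop j x)"
  using assms unfolding lce_def le_length_longest_common_prefix_iff by auto

lemma lce_commute: "lce x i j = lce x j i"
proof -
  have "longest_common_prefix xs ys = longest_common_prefix ys xs" for xs ys :: "'a list"
    by (induction xs ys rule: longest_common_prefix.induct) auto
  then show ?thesis unfolding lce_def by simp
qed

lemma lce_end [simp]: "lce x i (length x) = 0" "lce x (length x) i = 0"
  unfolding lce_def by simp_all

text \<open>The recursion of the update loop: the entry for \<open>d\<close> needs only the old
  entry for \<open>d + 1\<close>, so increasing \<open>d\<close> permits updating in place.\<close>

lemma lce_rec:
  assumes "i < length x" "j < length x"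
  shows "lce x i j = (if x ! i = x ! j then Suc (lce x (Suc i) (Suc j)) else 0)"
  using assms unfolding lce_def by (simp add: Cons_nth_drop_Suc[symmetric])

lemma lce_bound: "i \<le> length x \<Longrightarrow> j \<le> length x \<Longrightarrow> i + lce x i j \<le> length x"
  using le_lce_iff[of i x j "lce x i j"] by simp

definition prefix_rotation_at :: "'a list \<Rightarrow> nat \<Rightarrow> nat \<Rightarrow> bool" where
  "prefix_rotation_at x k j \<longleftrightarrow>
     j + k \<le> length x \<and> is_rotation (take k (drop j x)) (take k x)"

text \<open>Translates \<open>is_rotation_iff_extremal\<close> from equal substrings to bounds on
  extension lengths. Once \<open>D\<close> and \<open>m\<close> are known, two table lookups
  suffice.\<close>

lemma prefix_rotation_at_iff:
  assumes "0 < k" "j + k \<le> length x"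
    and D: "D \<le> k" "k \<le> D + lce x D j" "\<And>d. d < D \<Longrightarrow> d + lce x d j < k"
    and m: "m \<le> k" "k \<le> m + lce x (j + m) 0" "\<And>d. d < m \<Longrightarrow> d + lce x (j + d) 0 < k"
  shows "prefix_rotation_at x k j \<longleftrightarrow> D \<le> lce x (j + k - D) 0 \<or> m \<le> lce x (k - m) j"
proof -
  let ?u = "take k x" and ?v = "take k (drop j x)"
  have eq1: "k \<le> d + lce x d j \<longleftrightarrow> take (k - d) ?v = drop d ?u" if "d \<le> k" for d
    using that assms(2) le_lce_iff[of d x j "k - d"]
    by (auto simp: drop_take le_diff_conv)
  have eq2: "k \<le> d + lce x (j + d) 0 \<longleftrightarrow> drop d ?v = take (k - d) ?u" if "d \<le> k" for d
    using that assms(2) le_lce_iff[of "j + d" x 0 "k - d"]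
    by (auto simp: drop_take le_diff_conv add.commute)
  have "is_rotation ?v ?u \<longleftrightarrow> drop (k - D) ?v = take D ?u \<or> drop (k - m) ?u = take m ?v"
  proof (rule is_rotation_iff_extremal)
    show "take (k - d) ?v \<noteq> drop d ?u" if "d < D" for d
      using eq1[of d] D(1) D(3)[OF that] that by auto
    show "drop d ?v \<noteq> take (k - d) ?u" if "d < m" for d
      using eq2[of d] m(1) m(3)[OF that] that by auto
  qed (use assms eq1 eq2 in auto)
  moreover have "drop (k - D) ?v = take D ?u \<longleftrightarrow> D \<le> lce x (j + k - D) 0"
    using D(1) assms(2) le_lce_iff[of "j + k - D" x 0 D]
    by (auto simp: drop_take min_def add.commute)
  moreover have "drop (k - m) ?u = take m ?v \<longleftrightarrow> m \<le> lce x (k - m) j"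
    using m(1) assms(2) le_lce_iff[of "k - m" x j m]
    by (auto simp: drop_take min_def)
  ultimately show ?thesis using assms(2) by (simp add: prefix_rotation_at_def)
qed

subsection \<open>Greedy covering from the right\<close>

definition covers_from :: "'a list \<Rightarrow> nat \<Rightarrow> nat \<Rightarrow> bool" where
  "covers_from x k s \<longleftrightarrow>
     (\<forall>p. s \<le> p \<and> p < length x \<longrightarrow> (\<exists>t\<ge>s. t \<le> p \<and> p < t + k \<and> prefix_rotation_at x k t))"

text \<open>Only the prefix of length \<open>k\<close> covers the first position, so it is a
  rotation of any covering \<open>u\<close> and may replace \<open>u\<close>, by symmetry and
  transitivity.\<close>

lemma cyclic_coverable_iff:
  assumes "1 \<le> k" "k \<le> length x"
  shows "cyclic_coverable k x \<longleftrightarrow> covers_from x k 0"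
proof
  assume "cyclic_coverable k x"
  then obtain u where u: "length u = k" "cyclic_coverable_by x u"
    by (auto simp: cyclic_coverable_def)
  have win: "\<exists>t. t \<le> p \<and> p < t + k \<and> t + k \<le> length x \<and> is_rotation (take k (drop t x)) u"
    if p: "p < length x" for p
  proof -
    obtain \<beta> \<gamma> where *: "1 \<le> \<beta>" "\<beta> \<le> Suc p" "Suc p \<le> \<gamma>" "\<gamma> \<le> length x"
      "is_rotation (substring x \<beta> \<gamma>) u"
      using u(2)[unfolded cyclic_coverable_by_def, rule_format, of "Suc p"] p
      by (auto simp: Suc_le_eq)
    have "Suc \<gamma> - \<beta> = k"
      using is_rotation_length[OF *(5)] *(1,4) u(1) by (simp add: substring_def)
    then show ?thesis using * by (intro exI[of _ "\<beta> - 1"]) (auto simp: substring_def)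
  qed
  have "is_rotation (take k x) u" using win[of 0] assms by (cases x) auto
  then have "is_rotation v (take k x)" if "is_rotation v u" for v
    by (rule is_rotation_trans[OF that is_rotation_sym])
  then have "\<exists>t. t \<le> p \<and> p < t + k \<and> prefix_rotation_at x k t" if "p < length x" for p
    using win[OF that] unfolding prefix_rotation_at_def by auto
  then show "covers_from x k 0"
    unfolding covers_from_def by simp
next
  assume R: "covers_from x k 0"
  have "cyclic_coverable_by x (take k x)"
    unfolding cyclic_coverable_by_def
  proof (intro allI impI)
    fix i assume i: "1 \<le> i \<and> i \<le> length x"
    then have "i - 1 < length x" by linarith
    then obtain t where t: "t \<le> i - 1" "i - 1 < t + k" "prefix_rotation_at x k t"
      using R unfolding covers_from_def by blast
    have "substring x (Suc t) (t + k) = take k (drop t x)"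
      by (simp add: substring_def)
    then show "\<exists>\<beta> \<gamma>. 1 \<le> \<beta> \<and> \<beta> \<le> i \<and> i \<le> \<gamma> \<and> \<gamma> \<le> length x \<and>
        is_rotation (substring x \<beta> \<gamma>) (take k x)"
      using i t unfolding prefix_rotation_at_def
      by (intro exI[of _ "Suc t"] exI[of _ "t + k"] conjI) (simp_all, linarith+)
  qed
  then show "cyclic_coverable k x" unfolding cyclic_coverable_def
    using assms by (intro exI[of _ "take k x"]) simp
qed

text \<open>Length of the longest suffix of \<open>x\<close> of length at most \<open>i\<close> that is covered by rotations of
  the prefix of length \<open>k\<close>, computed by adding windows from right to left.\<close>

fun covered :: "'a list \<Rightarrow> nat \<Rightarrow> nat \<Rightarrow> nat" where
  "covered x k 0 = 0"
| "covered x k (Suc i) =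
     (if prefix_rotation_at x k (length x - Suc i) \<and>
         length x \<le> covered x k i + (length x - Suc i) + k
      then Suc i else covered x k i)"

lemma covered_le: "covered x k i \<le> i"
  by (induction i) (auto simp: le_Suc_eq)

text \<open>Position \<open>j + k\<close> lies beyond the window at \<open>j\<close>, so some window
  starts in between. With \<open>t\<close> the least such start, only the window at \<open>j\<close>
  is lost, and the one at \<open>t\<close> covers whatever it covered from \<open>t\<close>
  on.\<close>

lemma covers_from_next:
  assumes Q: "covers_from x k j" and jk: "j + k < length x" and k: "0 < k"
  obtains t where "j < t" "t \<le> j + k" "covers_from x k t"
proof -
  have "\<exists>t. j < t \<and> t \<le> j + k \<and> prefix_rotation_at x k t"
    using Q[unfolded covers_from_def, rule_format, of "j + k"] jk
    by (auto simp: le_less)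
  then obtain t where t: "j < t" "t \<le> j + k" "prefix_rotation_at x k t"
    and least: "\<And>t'. t' < t \<Longrightarrow> \<not> (j < t' \<and> t' \<le> j + k \<and> prefix_rotation_at x k t')"
    using exists_least_iff[of "\<lambda>t. j < t \<and> t \<le> j + k \<and> prefix_rotation_at x k t"] by auto
  have "covers_from x k t"
    unfolding covers_from_def
  proof (intro allI impI)
    fix p assume p: "t \<le> p \<and> p < length x"
    then obtain s where s: "j \<le> s" "s \<le> p" "p < s + k" "prefix_rotation_at x k s"
      using Q t unfolding covers_from_def by (metis le_trans less_imp_le)
    show "\<exists>s\<ge>t. s \<le> p \<and> p < s + k \<and> prefix_rotation_at x k s"
    proof (cases "t \<le> s")
      case False
      then have "s = j" using least[of s] s t by auto
      then show ?thesis using s t p by (intro exI[of _ t]) auto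
    qed (use s in auto)
  qed
  with t that show ?thesis by blast
qed

lemma covers_from_covered:
  assumes "0 < k" "i \<le> length x"
  shows "covers_from x k (length x - covered x k i)"
    and "\<And>s. length x - i \<le> s \<Longrightarrow> s \<le> length x \<Longrightarrow> covers_from x k s \<Longrightarrow> length x - covered x k i \<le> s"
proof -
  have "covers_from x k (length x - covered x k i) \<and>
    (\<forall>s. length x - i \<le> s \<and> s \<le> length x \<and> covers_from x k s \<longrightarrow> length x - covered x k i \<le> s)"
    using assms(2)
  proof (induction i)
    case 0
    show ?case by (auto simp: covers_from_def)
  next
    case (Suc i)
    define j c where "j = length x - Suc i" and "c = covered x k i"
    have ij: "length x - i = Suc j" "length x = Suc (i + j)" using Suc.prems by (auto simp: j_def)
    have c: "c \<le> i" using covered_le[of x k i] by (simp add: c_def)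
    have Q: "covers_from x k (length x - c)"
      and min: "\<And>s. Suc j \<le> s \<Longrightarrow> s \<le> length x \<Longrightarrow> covers_from x k s \<Longrightarrow> length x - c \<le> s"
      using Suc ij by (auto simp: c_def)
    have step: "covered x k (Suc i) =
      (if prefix_rotation_at x k j \<and> length x \<le> c + j + k then Suc i else c)"
      by (simp add: j_def c_def)
    \<comment> \<open>Only a window at \<open>j\<close> can cover \<open>j\<close>. It must reach
      some suffix that is covered on its own, and by \<open>min\<close> the longest one, of length
      \<open>c\<close>, is the easiest to reach.\<close>
    have "covers_from x k j \<longleftrightarrow> prefix_rotation_at x k j \<and> length x \<le> c + j + k"
    proof
      assume R: "covers_from x k j"
      have "prefix_rotation_at x k j" using R ij unfolding covers_from_def
        by (metis add_Suc_right le_add2 le_antisym le_imp_less_Suc le_refl add.commute)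
      moreover have "length x \<le> c + j + k"
      proof (cases "j + k < length x")
        case True
        then obtain t where "j < t" "t \<le> j + k" "covers_from x k t"
          using covers_from_next R assms(1) by blast
        then show ?thesis using min[of t] True by auto
      qed auto
      ultimately show "prefix_rotation_at x k j \<and> length x \<le> c + j + k" ..
    next
      assume *: "prefix_rotation_at x k j \<and> length x \<le> c + j + k"
      show "covers_from x k j" unfolding covers_from_def
      proof (intro allI impI)
        fix p assume p: "j \<le> p \<and> p < length x"
        show "\<exists>t\<ge>j. t \<le> p \<and> p < t + k \<and> prefix_rotation_at x k t"
        proof (cases "p < j + k")
          case False
          then have "length x - c \<le> p" using * by auto
          then obtain t where "length x - c \<le> t" "t \<le> p" "p < t + k" "prefix_rotation_at x k t"
            using Q p unfolding covers_from_def by blast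
          moreover have "j \<le> length x - c" using c ij by simp
          ultimately show ?thesis using le_trans by blast
        qed (use * p in auto)
      qed
    qed
    note R = this
    show ?case
    proof (cases "covers_from x k j")
      case True
      then show ?thesis using R step ij by auto
    next
      case False
      have "length x - c \<le> s" if "j \<le> s" "s \<le> length x" "covers_from x k s" for s
        using min[of s] that False by (cases "s = j") auto
      then show ?thesis using R step Q False unfolding j_def[symmetric] by auto
    qed
  qed
  then show "covers_from x k (length x - covered x k i)"
    and "\<And>s. length x - i \<le> s \<Longrightarrow> s \<le> length x \<Longrightarrow> covers_from x k s \<Longrightarrow> length x - covered x k i \<le> s"
    by auto
qed

lemma covered_length_iff:
  assumes "1 \<le> k" "k \<le> length x"
  shows "covered x k (length x) = length x \<longleftrightarrow> cyclic_coverable k x"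
proof -
  have "covers_from x k 0 \<longleftrightarrow> length x - covered x k (length x) = 0"
    using covers_from_covered[of k "length x" x] assms
    by (metis One_nat_def Suc_le_lessD bot_nat_0.extremum_uniqueI diff_self_eq_0 le_refl zero_le)
  then show ?thesis using cyclic_coverable_iff[OF assms] covered_le[of x k "length x"] by auto
qed

subsection \<open>Runs of a program\<close>

lemma run_numeral:
  "run w P x (numeral t) c = Option.bind (step w P x c) (run w P x (pred_numeral t))"
  by (simp add: numeral_eq_Suc)

lemma run_add: "run w P x (s + t) c = Option.bind (run w P x s c) (run w P x t)"
  by (induction s arbitrary: c) (auto split: bind_split)

text \<open>\<open>t\<close> is only an upper bound, so that branches of different lengths share one
  bound.\<close>

definition reaches ::
  "nat \<Rightarrow> program \<Rightarrow> 'a list \<Rightarrow> nat \<Rightarrow> config \<Rightarrow> (config \<Rightarrow> bool) \<Rightarrow> bool" where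
  "reaches w P x t c Q \<longleftrightarrow> (\<exists>s\<le>t. \<exists>c'. run w P x s c = Some c' \<and> Q c')"

lemma reachesI: "run w P x s c = Some c' \<Longrightarrow> s \<le> t \<Longrightarrow> Q c' \<Longrightarrow> reaches w P x t c Q"
  unfolding reaches_def by blast

lemma reaches_mono: "reaches w P x s c Q \<Longrightarrow> s \<le> t \<Longrightarrow> (\<And>c'. Q c' \<Longrightarrow> Q' c') \<Longrightarrow> reaches w P x t c Q'"
  unfolding reaches_def by (meson le_trans)

lemma reaches_trans:
  assumes "reaches w P x s c Q" "\<And>c'. Q c' \<Longrightarrow> reaches w P x t c' Q'"
  shows "reaches w P x (s + t) c Q'"
proof -
  obtain s' c' where s': "s' \<le> s" "run w P x s' c = Some c'" "Q c'"
    using assms(1) unfolding reaches_def by blast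
  obtain t' c'' where t': "t' \<le> t" "run w P x t' c' = Some c''" "Q' c''"
    using assms(2)[OF s'(3)] unfolding reaches_def by blast
  show ?thesis
    by (rule reachesI[of _ _ _ "s' + t'" _ c'']) (use s' t' in \<open>auto simp: run_add\<close>)
qed

text \<open>\<open>\<mu>\<close> strictly decreases, so at most \<open>\<mu> c\<close> passes
  continue; \<open>Suc\<close> accounts for the pass that leaves.\<close>

lemma reaches_loop:
  assumes "I c"
    and iter: "\<And>c. I c \<Longrightarrow> reaches w P x a c (\<lambda>c'. Q c' \<or> I c' \<and> \<mu> c' < \<mu> c)"
  shows "reaches w P x (a * Suc (\<mu> c)) c Q"
  using assms(1)
proof (induction "\<mu> c" arbitrary: c rule: less_induct)
  case less
  have "reaches w P x (a + a * \<mu> c) c Q"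
  proof (rule reaches_trans[OF iter[OF less.prems]])
    fix c' assume "Q c' \<or> I c' \<and> \<mu> c' < \<mu> c"
    then show "reaches w P x (a * \<mu> c) c' Q"
    proof
      assume "Q c'"
      then show ?thesis by (intro reachesI[of _ _ _ 0]) auto
    next
      assume c': "I c' \<and> \<mu> c' < \<mu> c"
      then have "a * Suc (\<mu> c') \<le> a * \<mu> c" by (intro mult_le_mono2) auto
      with less.hyps c' show ?thesis using reaches_mono by metis
    qed
  qed
  then show ?case by simp
qed

subsection \<open>The program\<close>

text \<open>
  Registers: 0 holds \<open>n\<close>, 1 the window start \<open>j\<close>, 2 and 3 the pointers \<open>D\<close> and \<open>m\<close> of
  \<open>prefix_rotation_at_iff\<close> (2 is also the index \<open>d\<close> of the update loop), 4 the length \<open>k\<close>,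
  5 to 7 temporaries, 8 the address \<open>2 * n + 1\<close>, 9 the constant 1, 10 the constant 0.
  Memory, while the windows from \<open>j\<close> on have been treated: cell \<open>k - 1\<close> holds
  \<open>covered x k (n - j)\<close>, cell \<open>n + d\<close> holds \<open>lce x d j\<close>, and cell \<open>2 * n + 1 + p\<close> holds
  \<open>lce x p 0\<close> for \<open>p \<ge> j\<close>.
\<close>

definition cover_program :: program where
  "cover_program =
   [Const 9 1, Add 1 0 10, Add 8 0 0, Add 8 8 9,
   \<comment> \<open>4: next j\<close> JumpLess 10 1 6, Jump 60, Sub 1 1 9, Const 2 0,
   \<comment> \<open>8: lce x d j from lce x (d + 1) (j + 1), for increasing d\<close>
     JumpLess 2 0 10, Jump 20, Const 5 0, Add 6 0 2, JumpSame 2 1 14, Jump 17,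
     Add 7 6 9, Load 5 7, Add 5 5 9, Store 6 5, Add 2 2 9, Jump 8,
   \<comment> \<open>20: store lce x j 0\<close> Load 5 0, Add 6 8 1, Store 6 5, Const 2 0, Const 3 0, Const 4 1,
   \<comment> \<open>26: leave if j + k > n\<close> Add 5 1 4, JumpLess 0 5 4,
   \<comment> \<open>28: D + lce x D j < k\<close> Add 5 0 2, Load 5 5, Add 5 5 2, JumpLess 5 4 56,
   \<comment> \<open>32: m + lce x (j + m) 0 < k\<close> Add 5 8 1, Add 5 5 3, Load 5 5, Add 5 5 3, JumpLess 5 4 58,
   \<comment> \<open>37: D \<le> lce x (j + k - D) 0\<close>
     Add 5 8 1, Add 5 5 4, Sub 5 5 2, Load 5 5, JumpLess 5 2 43, Jump 47,
   \<comment> \<open>43: m \<le> lce x (k - m) j\<close> Add 5 0 4, Sub 5 5 3, Load 5 5, JumpLess 5 3 54,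
   \<comment> \<open>47: window found\<close>
     Sub 6 4 9, Load 5 6, Add 5 5 1, Add 5 5 4, JumpLess 5 0 54, Sub 5 0 1, Store 6 5,
   \<comment> \<open>54: next k\<close> Add 4 4 9, Jump 26,
   \<comment> \<open>56: next D\<close> Add 2 2 9, Jump 26,
   \<comment> \<open>58: next m\<close> Add 3 3 9, Jump 26,
   \<comment> \<open>60: covered suffix lengths to answers\<close> Const 4 0, JumpLess 4 0 63, Jump 68,
     Load 5 4, Div 5 5 0, Store 4 5, Add 4 4 9, Jump 61]"

lemma length_cover_program [simp]: "length cover_program = 68"
  by (simp add: cover_program_def)

lemma step_cover_program:
  "pc < 68 \<Longrightarrow> step w cover_program x (pc, R, M) = exec w x (cover_program ! pc) (pc, R, M)"
  by (simp add: step_def)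

lemmas cover_program_nth = cover_program_def[THEN arg_cong, of "\<lambda>P. P ! pc" for pc]

lemmas exec_simps = run_numeral step_cover_program cover_program_nth

section \<open>Paths through the program, executed symbolically with exact step counts\<close>

context
  fixes x :: "'a list" and n w :: nat
  assumes n: "length x = n" and word: "4 * n + 4 < 2 ^ w"
begin

definition frame :: "(reg \<Rightarrow> nat) \<Rightarrow> bool" where
  "frame R \<longleftrightarrow> R 0 = n \<and> R 8 = 2 * n + 1 \<and> R 9 = 1 \<and> R 10 = 0"

lemma upd_same:
  assumes "frame R" "R 1 < n" "R 2 < n" "length M = 3 * n + 2" "x ! R 2 = x ! R 1"
    "M ! (n + R 2 + 1) \<le> n"
  shows "\<exists>R'. run w cover_program x 10 (8, R, M)
      = Some (8, R', M[n + R 2 := Suc (M ! (n + R 2 + 1))])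
    \<and> frame R' \<and> R' 1 = R 1 \<and> R' 2 = Suc (R 2)"
  using assms word n by (simp add: exec_simps frame_def)

lemma upd_diff:
  assumes "frame R" "R 1 < n" "R 2 < n" "length M = 3 * n + 2" "x ! R 2 \<noteq> x ! R 1"
  shows "\<exists>R'. run w cover_program x 8 (8, R, M) = Some (8, R', M[n + R 2 := 0])
    \<and> frame R' \<and> R' 1 = R 1 \<and> R' 2 = Suc (R 2)"
  using assms word n by (simp add: exec_simps frame_def)

lemma enter_outer_loop:
  assumes "R 0 = n" "R 10 = 0"
  shows "\<exists>R'. run w cover_program x 4 (0, R, M) = Some (4, R', M) \<and> frame R' \<and> R' 1 = n"
  using assms word n by (simp add: exec_simps frame_def)

lemma outer_exit:
  assumes "frame R" "R 1 = 0"
  shows "\<exists>R'. run w cover_program x 3 (4, R, M) = Some (61, R', M) \<and> frame R' \<and> R' 4 = 0"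
  using assms word n by (simp add: exec_simps frame_def)

lemma outer_enter:
  assumes "frame R" "0 < R 1" "R 1 \<le> n"
  shows "\<exists>R'. run w cover_program x 3 (4, R, M) = Some (8, R', M)
    \<and> frame R' \<and> R' 1 = R 1 - 1 \<and> R' 2 = 0"
  using assms word n by (simp add: exec_simps frame_def)

lemma upd_exit:
  assumes "frame R" "R 1 < n" "R 2 = n" "length M = 3 * n + 2" "M ! n \<le> n"
  shows "\<exists>R'. run w cover_program x 8 (8, R, M) = Some (26, R', M[2 * n + 1 + R 1 := M ! n])
    \<and> frame R' \<and> R' 1 = R 1 \<and> R' 2 = 0 \<and> R' 3 = 0 \<and> R' 4 = 1"
  using assms word n by (simp add: exec_simps frame_def)

lemma inner_exit:
  assumes "frame R" "R 1 < n" "n < R 1 + R 4" "R 1 + R 4 \<le> Suc n"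
  shows "\<exists>R'. run w cover_program x 2 (26, R, M) = Some (4, R', M)
    \<and> frame R' \<and> R' 1 = R 1"
  using assms word n by (simp add: exec_simps frame_def)

lemma inner_advance_suffix:
  assumes "frame R" "R 1 + R 4 \<le> n" "R 2 \<le> R 4" "length M = 3 * n + 2"
    "R 2 + M ! (n + R 2) < R 4"
  shows "\<exists>R'. run w cover_program x 8 (26, R, M) = Some (26, R', M)
    \<and> frame R' \<and> R' 1 = R 1 \<and> R' 2 = Suc (R 2) \<and> R' 3 = R 3 \<and> R' 4 = R 4"
  using assms word n by (simp add: exec_simps frame_def add.commute)

lemma inner_advance_window:
  assumes "frame R" "R 1 + R 4 \<le> n" "R 2 \<le> R 4" "R 3 \<le> R 4" "length M = 3 * n + 2"
    "\<not> R 2 + M ! (n + R 2) < R 4" "M ! (n + R 2) \<le> n"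
    "R 3 + M ! (2 * n + 1 + R 1 + R 3) < R 4"
  shows "\<exists>R'. run w cover_program x 13 (26, R, M) = Some (26, R', M)
    \<and> frame R' \<and> R' 1 = R 1 \<and> R' 2 = R 2 \<and> R' 3 = Suc (R 3) \<and> R' 4 = R 4"
  using assms word n by (simp add: exec_simps frame_def add.commute)

text \<open>The second comparison is skipped when the first succeeds, hence 17 or 20 steps.\<close>

lemma inner_test:
  assumes R: "frame R" "R 1 + R 4 \<le> n" "1 \<le> R 4" "R 2 \<le> R 4" "R 3 \<le> R 4" "length M = 3 * n + 2"
    "\<not> R 2 + M ! (n + R 2) < R 4" "M ! (n + R 2) \<le> n"
    "\<not> R 3 + M ! (2 * n + 1 + R 1 + R 3) < R 4" "M ! (2 * n + 1 + R 1 + R 3) \<le> n"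
    "M ! (2 * n + 1 + R 1 + R 4 - R 2) \<le> n" "M ! (n + R 4 - R 3) \<le> n"
  shows "\<exists>R'. run w cover_program x
      (if R 2 \<le> M ! (2 * n + 1 + R 1 + R 4 - R 2) then 17 else 20) (26, R, M) =
    Some (if R 2 \<le> M ! (2 * n + 1 + R 1 + R 4 - R 2) \<or> R 3 \<le> M ! (n + R 4 - R 3) then 47 else 54, R', M)
    \<and> frame R' \<and> (\<forall>r\<in>{1, 2, 3, 4}. R' r = R r)"
  using assms word n by (auto simp: exec_simps frame_def add.commute)

lemma inner_record:
  assumes "frame R" "R 1 + R 4 \<le> n" "1 \<le> R 4" "length M = 3 * n + 2" "M ! (R 4 - 1) \<le> n"
  shows "\<exists>R'. run w cover_program x (if n \<le> M ! (R 4 - 1) + R 1 + R 4 then 7 else 5) (47, R, M) =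
    Some (54, R', if n \<le> M ! (R 4 - 1) + R 1 + R 4 then M[R 4 - 1 := n - R 1] else M)
    \<and> frame R' \<and> (\<forall>r\<in>{1, 2, 3, 4}. R' r = R r)"
  using assms word n by (auto simp: exec_simps frame_def add.commute)

lemma inner_next:
  assumes "frame R" "R 4 \<le> n"
  shows "\<exists>R'. run w cover_program x 2 (54, R, M) = Some (26, R', M)
    \<and> frame R' \<and> R' 4 = Suc (R 4) \<and> (\<forall>r\<in>{1, 2, 3}. R' r = R r)"
  using assms word n by (auto simp: exec_simps frame_def add.commute)

lemma final_exit:
  assumes "frame R" "R 4 = n"
  shows "\<exists>R'. run w cover_program x 2 (61, R, M) = Some (68, R', M)"
  using assms word n by (auto simp: exec_simps frame_def add.commute)

lemma final_step:
  assumes "frame R" "R 4 < n" "length M = 3 * n + 2" "M ! R 4 \<le> n"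
  shows "\<exists>R'. run w cover_program x 6 (61, R, M) = Some (61, R', M[R 4 := M ! R 4 div n])
     \<and> frame R' \<and> R' 4 = Suc (R 4)"
proof -
  have "M ! R 4 div n \<le> n" using assms(4) div_le_dividend le_trans by blast
  then show ?thesis
    using assms word n by (auto simp: exec_simps frame_def add.commute)
qed

subsection \<open>Invariants and running time\<close>

text \<open>Both tables include the index \<open>n\<close> of the empty suffix, a sentinel entry
  0.\<close>

definition arrays :: "nat \<Rightarrow> nat list \<Rightarrow> bool" where
  "arrays j M \<longleftrightarrow> length M = 3 * n + 2 \<and> (\<forall>d\<le>n. M ! (n + d) = lce x d j) \<and>
     (\<forall>p. j \<le> p \<and> p \<le> n \<longrightarrow> M ! (2 * n + 1 + p) = lce x p 0)"

definition outer_inv :: "config \<Rightarrow> bool" where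
  "outer_inv = (\<lambda>(pc, R, M). pc = 4 \<and> frame R \<and> R 1 \<le> n \<and> arrays (R 1) M \<and>
     (\<forall>k<n. M ! k = covered x (Suc k) (n - R 1)))"

definition upd_inv :: "nat \<Rightarrow> config \<Rightarrow> bool" where
  "upd_inv j = (\<lambda>(pc, R, M). pc = 8 \<and> frame R \<and> R 1 = j \<and> R 2 \<le> n \<and> length M = 3 * n + 2 \<and>
     (\<forall>d\<le>n. M ! (n + d) = lce x d (if d < R 2 then j else Suc j)) \<and>
     (\<forall>p. Suc j \<le> p \<and> p \<le> n \<longrightarrow> M ! (2 * n + 1 + p) = lce x p 0) \<and>
     (\<forall>k<n. M ! k = covered x (Suc k) (n - Suc j)))"

text \<open>The pointers need not be minimal splits yet: all smaller candidates are refuted for the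
  current length, and remain so as \<open>R 4\<close> grows. Hence no pointer moves back.\<close>

definition inner_inv :: "nat \<Rightarrow> config \<Rightarrow> bool" where
  "inner_inv j = (\<lambda>(pc, R, M). pc = 26 \<and> frame R \<and> R 1 = j \<and> 1 \<le> R 4 \<and> j + R 4 \<le> Suc n \<and>
     R 2 \<le> R 4 \<and> (\<forall>d<R 2. d + lce x d j < R 4) \<and>
     R 3 \<le> R 4 \<and> (\<forall>d<R 3. d + lce x (j + d) 0 < R 4) \<and> arrays j M \<and>
     (\<forall>k<n. M ! k = covered x (Suc k) (if Suc k < R 4 then n - j else n - Suc j)))"

definition final_inv :: "config \<Rightarrow> bool" where
  "final_inv = (\<lambda>(pc, R, M). pc = 61 \<and> frame R \<and> R 4 \<le> n \<and> length M = 3 * n + 2 \<and>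
     (\<forall>k<n. M ! k = (if k < R 4 then covered x (Suc k) n div n else covered x (Suc k) n)))"

lemma lce_le: "i \<le> n \<Longrightarrow> j \<le> n \<Longrightarrow> lce x i j \<le> n"
  using lce_bound[of i x j] n by simp

lemma upd_loop:
  assumes "j < n" "upd_inv j c"
  shows "reaches w cover_program x (10 * Suc n) c (inner_inv j)"
proof -
  have "reaches w cover_program x (10 * Suc ((\<lambda>(pc, R, M). n - R 2) c)) c (inner_inv j)"
  proof (rule reaches_loop[where I = "upd_inv j"])
    fix c assume "upd_inv j c"
    then obtain R M where c: "c = (8, R, M)" and R: "frame R" "R 1 = j" "R 2 \<le> n"
      and M: "length M = 3 * n + 2"
        "\<And>d. d \<le> n \<Longrightarrow> M ! (n + d) = lce x d (if d < R 2 then j else Suc j)"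
        "\<And>p. Suc j \<le> p \<Longrightarrow> p \<le> n \<Longrightarrow> M ! (2 * n + 1 + p) = lce x p 0"
        "\<And>k. k < n \<Longrightarrow> M ! k = covered x (Suc k) (n - Suc j)"
      by (cases c) (auto simp: upd_inv_def)
    show "reaches w cover_program x 10 c
      (\<lambda>c'. inner_inv j c' \<or> upd_inv j c' \<and> (\<lambda>(pc, R, M). n - R 2) c' < (\<lambda>(pc, R, M). n - R 2) c)"
    proof (cases "R 2 = n")
      case True
      have "M ! n = lce x 0 j" using M(2)[of 0] True assms(1) by simp
      \<comment> \<open>The loop never writes the sentinel entry; it is 0 for both \<open>j\<close>
        and \<open>Suc j\<close>.\<close>
      moreover have "lce x n (Suc j) = lce x n j" using lce_end[of x] n by simp
      ultimately have A: "M ! n = lce x 0 j" "\<And>d. d \<le> n \<Longrightarrow> M ! (n + d) = lce x d j"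
        using M(2) True by (auto simp: le_less)
      then obtain R' where R': "run w cover_program x 8 (8, R, M) = Some (26, R', M[2 * n + 1 + R 1 := M ! n])"
        "frame R'" "R' 1 = R 1" "R' 2 = 0" "R' 3 = 0" "R' 4 = 1"
        using upd_exit[of R M] R M(1) True lce_le[of 0 j] assms(1) by auto
      have "inner_inv j (26, R', M[2 * n + 1 + R 1 := M ! n])"
        unfolding inner_inv_def arrays_def
        using R R' M(1,3,4) A assms(1) lce_commute[of x 0 j] by (auto simp: nth_list_update)
      then show ?thesis using R'(1) unfolding c by (intro reachesI[where s = 8]) auto
    next
      case False
      then have lt: "R 2 < n" using R by simp
      have old: "M ! (n + R 2 + 1) = lce x (Suc (R 2)) (Suc j)" using M(2)[of "Suc (R 2)"] lt by simp
      define M' where "M' = M[n + R 2 := lce x (R 2) j]"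
      obtain s R' where R': "s \<le> 10" "run w cover_program x s (8, R, M) = Some (8, R', M')"
        "frame R'" "R' 1 = R 1" "R' 2 = Suc (R 2)"
      proof (cases "x ! R 2 = x ! R 1")
        case True
        then show ?thesis
          using upd_same[of R M] R lt M(1) assms(1) old lce_le[of "Suc (R 2)" "Suc j"] n
            lce_rec[of "R 2" x j] that[of 10] by (auto simp: M'_def)
      next
        case False
        then show ?thesis
          using upd_diff[of R M] R lt M(1) assms(1) n
            lce_rec[of "R 2" x j] that[of 8] by (auto simp: M'_def)
      qed
      have "upd_inv j (8, R', M')"
        unfolding upd_inv_def M'_def
        using R R' lt M assms(1) by (auto simp: nth_list_update)
      then show ?thesis using R' lt unfolding c by (intro reachesI[where s = s]) auto
    qed
  qed (use assms in auto)
  then show ?thesis by (rule reaches_mono) (auto split: prod.splits)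
qed

lemma covered_step:
  assumes "j < n" "k < n"
  shows "covered x (Suc k) (n - j) =
    (if prefix_rotation_at x (Suc k) j \<and> n \<le> covered x (Suc k) (n - Suc j) + j + Suc k
     then n - j else covered x (Suc k) (n - Suc j))"
proof -
  have "n - j = Suc (n - Suc j)" "length x - Suc (n - Suc j) = j" using assms n by auto
  then show ?thesis using n by simp
qed

text \<open>A pass that stays in the loop advances exactly one of the pointers and the length, each
  at most \<open>Suc n\<close>. The longest pass takes 20 steps to test, 7 to record and 2 to move
  on.\<close>

lemma inner_iteration:
  assumes "j < n" "inner_inv j c"
  shows "reaches w cover_program x 29 c
    (\<lambda>c'. outer_inv c' \<and> (fst \<circ> snd) c' 1 = j \<or>
      inner_inv j c' \<and>
      (\<lambda>(pc, R, M). 3 * Suc n - (R 2 + R 3 + R 4)) c' < (\<lambda>(pc, R, M). 3 * Suc n - (R 2 + R 3 + R 4)) c)"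
proof -
  obtain R M where c: "c = (26, R, M)" and R: "frame R" "R 1 = j" "1 \<le> R 4" "j + R 4 \<le> Suc n"
      "R 2 \<le> R 4" "\<And>d. d < R 2 \<Longrightarrow> d + lce x d j < R 4"
      "R 3 \<le> R 4" "\<And>d. d < R 3 \<Longrightarrow> d + lce x (j + d) 0 < R 4"
    and arr: "arrays j M"
    and out: "\<And>k. k < n \<Longrightarrow> M ! k = covered x (Suc k) (if Suc k < R 4 then n - j else n - Suc j)"
    using assms(2) by (cases c) (auto simp: inner_inv_def)
  have len: "length M = 3 * n + 2" and A: "\<And>d. d \<le> n \<Longrightarrow> M ! (n + d) = lce x d j"
    and Z: "\<And>p. j \<le> p \<Longrightarrow> p \<le> n \<Longrightarrow> M ! (2 * n + 1 + p) = lce x p 0"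
    using arr by (auto simp: arrays_def)
  consider (exit) "n < j + R 4" | (D) "j + R 4 \<le> n" "R 2 + lce x (R 2) j < R 4"
    | (m) "j + R 4 \<le> n" "\<not> R 2 + lce x (R 2) j < R 4" "R 3 + lce x (j + R 3) 0 < R 4"
    | (test) "j + R 4 \<le> n" "\<not> R 2 + lce x (R 2) j < R 4" "\<not> R 3 + lce x (j + R 3) 0 < R 4"
    by linarith
  then show ?thesis
  proof cases
    case exit
    then obtain R' where R': "run w cover_program x 2 (26, R, M) = Some (4, R', M)" "frame R'" "R' 1 = j"
      using inner_exit[of R M] R assms(1) by auto
    \<comment> \<open>Lengths from \<open>R 4\<close> on were not treated for this \<open>j\<close>;
      their windows would overrun \<open>x\<close>, so \<open>covered\<close> does not
      change.\<close>
    have "M ! k = covered x (Suc k) (n - j)" if "k < n" for k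
      using out[OF that] covered_step[OF assms(1) that] exit n
      by (auto simp: prefix_rotation_at_def)
    then have "outer_inv (4, R', M)" unfolding outer_inv_def using R' arr assms(1) by auto
    then show ?thesis using R' unfolding c by (intro reachesI[where s = 2]) auto
  next
    case D
    then have "M ! (n + R 2) = lce x (R 2) j" using A R by simp
    then obtain R' where R': "run w cover_program x 8 (26, R, M) = Some (26, R', M)" "frame R'"
      "R' 1 = R 1" "R' 2 = Suc (R 2)" "R' 3 = R 3" "R' 4 = R 4"
      using inner_advance_suffix[of R M] R D len by auto
    have "inner_inv j (26, R', M)" unfolding inner_inv_def
      using R' R D arr out by (auto simp: less_Suc_eq)
    then show ?thesis using R' R D unfolding c by (intro reachesI[where s = 8]) auto
  next
    case m
    have "M ! (n + R 2) = lce x (R 2) j" "M ! (2 * n + 1 + R 1 + R 3) = lce x (j + R 3) 0"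
      using A[of "R 2"] Z[of "j + R 3"] R m by (simp_all add: add.assoc)
    then obtain R' where R': "run w cover_program x 13 (26, R, M) = Some (26, R', M)" "frame R'"
      "R' 1 = R 1" "R' 2 = R 2" "R' 3 = Suc (R 3)" "R' 4 = R 4"
      using inner_advance_window[of R M] R m len lce_le[of "R 2" j] by auto
    have "inner_inv j (26, R', M)" unfolding inner_inv_def
      using R' R m arr out by (auto simp: less_Suc_eq)
    then show ?thesis using R' R m unfolding c by (intro reachesI[where s = 13]) auto
  next
    case test
    define k where "k = R 4"
    have k: "1 \<le> k" "j + k \<le> n" using test R by (auto simp: k_def)
    have mem: "M ! (n + R 2) = lce x (R 2) j" "M ! (2 * n + 1 + R 1 + R 3) = lce x (j + R 3) 0"
      "M ! (2 * n + 1 + R 1 + R 4 - R 2) = lce x (j + k - R 2) 0"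
      "M ! (n + R 4 - R 3) = lce x (k - R 3) j"
    proof -
      have "2 * n + 1 + R 1 + R 4 - R 2 = 2 * n + 1 + (j + k - R 2)" "n + R 4 - R 3 = n + (k - R 3)"
        using R by (auto simp: k_def)
      then show "M ! (2 * n + 1 + R 1 + R 4 - R 2) = lce x (j + k - R 2) 0"
        "M ! (n + R 4 - R 3) = lce x (k - R 3) j"
        using Z[of "j + k - R 2"] A[of "k - R 3"] R k by (simp_all add: k_def)
    qed (use A[of "R 2"] Z[of "j + R 3"] R k in \<open>simp_all add: add.assoc k_def\<close>)
    \<comment> \<open>Both advance conditions fail, so together with the invariant the pointers are
      now minimal.\<close>
    have rot: "prefix_rotation_at x k j \<longleftrightarrow> R 2 \<le> lce x (j + k - R 2) 0 \<or> R 3 \<le> lce x (k - R 3) j"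
      using R test k n by (intro prefix_rotation_at_iff) (auto simp: k_def)
    have "lce x (R 2) j \<le> n" "lce x (j + R 3) 0 \<le> n" "lce x (j + k - R 2) 0 \<le> n"
      "lce x (k - R 3) j \<le> n"
      using lce_le R k assms(1) by (auto simp: k_def)
    moreover define s where "s = (if R 2 \<le> lce x (j + k - R 2) 0 then 17 else 20 :: nat)"
    ultimately have "\<exists>R1. run w cover_program x s (26, R, M) =
        Some (if prefix_rotation_at x k j then 47 else 54, R1, M)
      \<and> frame R1 \<and> (\<forall>r\<in>{1, 2, 3, 4}. R1 r = R r)"
      using inner_test[of R M, unfolded mem, folded rot s_def] R test len by simp
    moreover have "s \<le> 20" by (simp add: s_def)
    ultimately obtain R1 where R1: "s \<le> 20"
      "run w cover_program x s (26, R, M) = Some (if prefix_rotation_at x k j then 47 else 54, R1, M)"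
      "frame R1" "\<forall>r\<in>{1, 2, 3, 4}. R1 r = R r"
      by blast
    have old: "M ! (k - 1) = covered x k (n - Suc j)"
      using out[of "k - 1"] k by (simp add: k_def)
    define M' where "M' = M[k - 1 := covered x k (n - j)]"
    have new: "covered x k (n - j) =
        (if prefix_rotation_at x k j \<and> n \<le> M ! (k - 1) + j + k then n - j else M ! (k - 1))"
      using covered_step[of j "k - 1"] assms(1) k old by simp
    have M'_id: "M' = M" if "covered x k (n - j) = M ! (k - 1)"
      unfolding M'_def using that by (metis list_update_id)
    obtain t R2 where R2: "t \<le> 7"
      "run w cover_program x t (if prefix_rotation_at x k j then 47 else 54, R1, M) = Some (54, R2, M')"
      "frame R2" "\<forall>r\<in>{1, 2, 3, 4}. R2 r = R r"
    proof (cases "prefix_rotation_at x k j")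
      case True
      have "M ! (k - 1) \<le> n" using covered_le[of x k "n - Suc j"] old by simp
      then obtain R2 where "run w cover_program x (if n \<le> M ! (k - 1) + j + k then 7 else 5) (47, R1, M)
          = Some (54, R2, if n \<le> M ! (k - 1) + j + k then M[k - 1 := n - j] else M)"
        "frame R2" "\<forall>r\<in>{1, 2, 3, 4}. R2 r = R r"
        using inner_record[of R1 M] R1 R k len by (auto simp: k_def)
      moreover have "M' = (if n \<le> M ! (k - 1) + j + k then M[k - 1 := n - j] else M)"
        using new True M'_id by (auto simp: M'_def)
      moreover have "(if n \<le> M ! (k - 1) + j + k then 7 else 5) \<le> (7 :: nat)" by simp
      ultimately show ?thesis using True that by metis
    next
      case False
      then show ?thesis using R1 M'_id new that[of 0 R1] by auto
    qed
    obtain R3 where R3: "run w cover_program x 2 (54, R2, M') = Some (26, R3, M')"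
      "frame R3" "R3 4 = Suc k" "\<forall>r\<in>{1, 2, 3}. R3 r = R r"
      using inner_next[of R2 M'] R2 k by (auto simp: k_def)
    have "run w cover_program x (s + (t + 2)) c = Some (26, R3, M')"
      unfolding c run_add by (simp only: R1(2) R2(2) R3(1) bind.simps)
    moreover have "inner_inv j (26, R3, M')"
    proof -
      have "arrays j M'" using arr k unfolding arrays_def M'_def by auto
      moreover have "M' ! i = covered x (Suc i) (if Suc i < Suc k then n - j else n - Suc j)" if "i < n" for i
        using out[OF that] that len k by (auto simp: M'_def nth_list_update k_def[symmetric])
      ultimately show ?thesis
        unfolding inner_inv_def using R3 R k by (auto simp: k_def less_Suc_eq)
    qed
    ultimately show ?thesis using R1(1) R2(1) R3 R k
      by (intro reachesI[where s = "s + (t + 2)"]) (auto simp: c k_def)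
  qed
qed

lemma inner_loop:
  assumes "j < n" "inner_inv j c"
  shows "reaches w cover_program x (29 * (3 * n + 4)) c (\<lambda>c'. outer_inv c' \<and> (fst \<circ> snd) c' 1 = j)"
proof -
  have "reaches w cover_program x (29 * Suc ((\<lambda>(pc, R, M). 3 * Suc n - (R 2 + R 3 + R 4)) c)) c
      (\<lambda>c'. outer_inv c' \<and> (fst \<circ> snd) c' 1 = j)"
    using inner_iteration[OF assms(1)] assms(2) by (intro reaches_loop[where I = "inner_inv j"]) auto
  then show ?thesis by (rule reaches_mono) (auto split: prod.splits)
qed

text \<open>The bound is the sum of 3 for entering, \<open>10 * Suc n\<close> for the update loop
  and \<open>29 * (3 * n + 4)\<close> for the inner loop.\<close>

lemma outer_iteration:
  assumes "outer_inv c"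
  shows "reaches w cover_program x (97 * n + 129) c
    (\<lambda>c'. final_inv c' \<or> outer_inv c' \<and> (fst \<circ> snd) c' 1 < (fst \<circ> snd) c 1)"
proof -
  obtain R M where c: "c = (4, R, M)" and R: "frame R" "R 1 \<le> n" and arr: "arrays (R 1) M"
    and out: "\<And>k. k < n \<Longrightarrow> M ! k = covered x (Suc k) (n - R 1)"
    using assms by (cases c) (auto simp: outer_inv_def)
  show ?thesis
  proof (cases "R 1 = 0")
    case True
    then obtain R' where R': "run w cover_program x 3 (4, R, M) = Some (61, R', M)" "frame R'" "R' 4 = 0"
      using outer_exit R by blast
    have "final_inv (61, R', M)" unfolding final_inv_def using R' arr out True by (auto simp: arrays_def)
    then show ?thesis using R' unfolding c by (intro reachesI[where s = 3]) auto
  next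
    case False
    define j where "j = R 1 - 1"
    have j: "j < n" "Suc j = R 1" using False R by (auto simp: j_def)
    obtain R' where R': "run w cover_program x 3 (4, R, M) = Some (8, R', M)" "frame R'" "R' 1 = j" "R' 2 = 0"
      using outer_enter[of R M] R False by (auto simp: j_def)
    have "upd_inv j (8, R', M)"
      unfolding upd_inv_def using R' arr out j by (auto simp: arrays_def)
    then have "reaches w cover_program x 3 c (upd_inv j)"
      using R' unfolding c by (intro reachesI[where s = 3]) auto
    from reaches_trans[OF reaches_trans[OF this upd_loop[OF j(1)]] inner_loop[OF j(1)]]
    show ?thesis by (rule reaches_mono) (use j c in auto)
  qed
qed

lemma final_loop:
  assumes "final_inv c"
  shows "reaches w cover_program x (6 * Suc n) c (\<lambda>(pc, R, M). pc = 68 \<and> n \<le> length M \<and>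
    (\<forall>k<n. M ! k = covered x (Suc k) n div n))" (is "reaches _ _ _ _ _ ?Q")
proof -
  have "reaches w cover_program x (6 * Suc ((\<lambda>(pc, R, M). n - R 4) c)) c ?Q"
  proof (rule reaches_loop[where I = final_inv])
    fix c assume "final_inv c"
    then obtain R M where c: "c = (61, R, M)" and R: "frame R" "R 4 \<le> n"
      and M: "length M = 3 * n + 2"
        "\<And>k. k < n \<Longrightarrow> M ! k = (if k < R 4 then covered x (Suc k) n div n else covered x (Suc k) n)"
      by (cases c) (auto simp: final_inv_def)
    show "reaches w cover_program x 6 c
      (\<lambda>c'. ?Q c' \<or> final_inv c' \<and> (\<lambda>(pc, R, M). n - R 4) c' < (\<lambda>(pc, R, M). n - R 4) c)"
    proof (cases "R 4 = n")
      case True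
      then obtain R' where "run w cover_program x 2 (61, R, M) = Some (68, R', M)"
        using final_exit R by blast
      then show ?thesis using M True unfolding c by (intro reachesI[where s = 2]) auto
    next
      case False
      then have lt: "R 4 < n" using R by simp
      then obtain R' where R': "run w cover_program x 6 (61, R, M) = Some (61, R', M[R 4 := M ! R 4 div n])"
        "frame R'" "R' 4 = Suc (R 4)"
        using final_step[of R M] R M(1) M(2)[of "R 4"] covered_le[of x "Suc (R 4)" n] by auto
      have "final_inv (61, R', M[R 4 := M ! R 4 div n])"
        unfolding final_inv_def using R' M lt by (auto simp: nth_list_update)
      then show ?thesis using R' lt unfolding c by (intro reachesI[where s = 6]) auto
    qed
  qed (use assms in auto)
  then show ?thesis by (rule reaches_mono) (auto split: prod.splits)
qed

lemma cover_program_correct: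
  "\<exists>t M. t \<le> 4 + (97 * n + 129) * Suc n + 6 * Suc n \<and>
     halts_with (3 * n + 2) w cover_program x t M \<and> n \<le> length M \<and>
     (\<forall>k. 1 \<le> k \<and> k \<le> n \<longrightarrow> M ! (k - 1) = (if cyclic_coverable k x then 1 else 0))"
proof -
  obtain R where R: "run w cover_program x 4 (init (3 * n + 2) x) = Some (4, R, replicate (3 * n + 2) 0)"
    "frame R" "R 1 = n"
    using enter_outer_loop[of "(\<lambda>_. 0)(0 := n)" "replicate (3 * n + 2) 0"] n by (auto simp: init_def)
  \<comment> \<open>Zero memory is correct for \<open>j = n\<close>: the empty suffix has only empty
    extensions and nothing is covered.\<close>
  have inv: "outer_inv (4, R, replicate (3 * n + 2) 0)"
    unfolding outer_inv_def arrays_def using R lce_end[of x] n by (auto simp: nth_append simp del: replicate.simps)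
  have 1: "reaches w cover_program x 4 (init (3 * n + 2) x) (\<lambda>c. outer_inv c \<and> (fst \<circ> snd) c 1 = n)"
    using inv R by (intro reachesI[where s = 4]) auto
  have 2: "reaches w cover_program x ((97 * n + 129) * Suc n) c final_inv"
    if "outer_inv c \<and> (fst \<circ> snd) c 1 = n" for c
    using reaches_loop[where I = outer_inv and Q = final_inv and \<mu> = "\<lambda>c. (fst \<circ> snd) c 1", OF _ outer_iteration, of c] that
    by simp
  obtain t R' M where t: "t \<le> 4 + (97 * n + 129) * Suc n + 6 * Suc n"
    "run w cover_program x t (init (3 * n + 2) x) = Some (68, R', M)"
    "n \<le> length M" "\<And>k. k < n \<Longrightarrow> M ! k = covered x (Suc k) n div n"
    using reaches_trans[OF reaches_trans[OF 1 2] final_loop] unfolding reaches_def by auto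
  have "M ! (k - 1) = (if cyclic_coverable k x then 1 else 0)" if "1 \<le> k \<and> k \<le> n" for k
  proof -
    \<comment> \<open>As \<open>covered x k n\<close> is at most \<open>n\<close> and
      \<open>n\<close> is positive, the quotient is 1 exactly at \<open>n\<close> and 0
      below.\<close>
    have "M ! (k - 1) = covered x k n div n" using t(4)[of "k - 1"] that by (cases k) auto
    moreover have "covered x k n = n \<longleftrightarrow> cyclic_coverable k x"
      using covered_length_iff[of k x] that n by simp
    moreover have "covered x k n \<le> n" by (rule covered_le)
    ultimately show ?thesis using that by auto
  qed
  moreover have "halts_with (3 * n + 2) w cover_program x t M"
    unfolding halts_with_def using t(2) n word by auto
  ultimately show ?thesis using t(1,3) by blast
qed

end

section \<open>Asymptotic bounds on time, space and word length\<close>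

theorem theorem5:
  "\<exists>(P :: program) (T :: nat \<Rightarrow> nat) (S :: nat \<Rightarrow> nat) (w :: nat \<Rightarrow> nat).
     (\<lambda>n. real (T n)) \<in> O(\<lambda>n. real n ^ 2) \<and>
     (\<lambda>n. real (S n)) \<in> O(\<lambda>n. real n) \<and>
     (\<lambda>n. real (w n)) \<in> O(\<lambda>n. log 2 (real n)) \<and>
     (\<forall>(x :: 'a list) n. length x = n \<longrightarrow>
        (\<exists>t M. t \<le> T n \<and> halts_with (S n) (w n) P x t M \<and> n \<le> length M \<and>
           (\<forall>k'. 1 \<le> k' \<and> k' \<le> n \<longrightarrow>
              M ! (k' - 1) = (if cyclic_coverable k' x then 1 else 0))))"
proof -
  define T where "T n = 4 + (97 * n + 129) * Suc n + 6 * Suc n" for n :: nat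
  \<comment> \<open>The least word length that can hold \<open>4 * n + 4\<close>, a bound on every
    number the program forms.\<close>
  define w where "w n = nat \<lceil>log 2 (real (4 * n + 5))\<rceil>" for n :: nat
  have T: "(\<lambda>n. real (T n)) \<in> O(\<lambda>n. real n ^ 2)"
  proof (rule bigoI[where c = 468], rule eventually_mono[OF eventually_ge_at_top[of 1]])
    fix n :: nat assume n: "1 \<le> n"
    have "T n = 97 * n ^ 2 + 232 * n + 139" by (simp add: T_def power2_eq_square algebra_simps)
    \<comment> \<open>Here \<open>468 = 97 + 232 + 139\<close>, as both 1 and \<open>n\<close> are
      at most \<open>n ^ 2\<close>.\<close>
    also have "\<dots> \<le> 468 * n ^ 2" using n self_le_power[of n 2] by simp
    finally show "norm (real (T n)) \<le> 468 * norm (real n ^ 2)"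
      by (metis norm_of_nat of_nat_le_iff of_nat_mult of_nat_numeral of_nat_power)
  qed
  have S: "(\<lambda>n. real (3 * n + 2)) \<in> O(\<lambda>n. real n)"
    by (rule bigoI[where c = 5], rule eventually_mono[OF eventually_ge_at_top[of 1]]) auto
  have w: "(\<lambda>n. real (w n)) \<in> O(\<lambda>n. log 2 (real n))"
  proof (rule bigoI[where c = 6], rule eventually_mono[OF eventually_ge_at_top[of 2]])
    fix n :: nat assume n: "2 \<le> n"
    have "log 2 2 \<le> log 2 (real n)" using n by (subst log_le_cancel_iff) auto
    then have 1: "1 \<le> log 2 (real n)" by simp
    \<comment> \<open>Rounding up adds at most 1 to the 4 obtained here; \<open>n \<ge> 2\<close>
      makes the logarithm at least 1, so it absorbs this 5.\<close>
    have "log 2 (real (4 * n + 5)) \<le> log 2 (2 ^ 4 * real n)"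
      using n by (subst log_le_cancel_iff) auto
    also have "\<dots> = 4 + log 2 (real n)" using n by (subst log_mult) (use log_pow_cancel[of 2 4] in auto)
    finally have "real (w n) \<le> 5 + log 2 (real n)" using 1 unfolding w_def by linarith
    then show "norm (real (w n)) \<le> 6 * norm (log 2 (real n))" using 1 by simp
  qed
  have word: "4 * n + 4 < 2 ^ w n" for n
  proof -
    have "real (4 * n + 5) = 2 powr log 2 (real (4 * n + 5))" by simp
    also have "\<dots> \<le> 2 powr real (w n)" unfolding w_def by (intro powr_mono) linarith+
    also have "\<dots> = real (2 ^ w n)" by (simp add: powr_realpow)
    finally show ?thesis by linarith
  qed
  show ?thesis
    by (rule exI[of _ cover_program], rule exI[of _ T], rule exI[of _ "\<lambda>n. 3 * n + 2"],
        rule exI[of _ w], intro conjI allI impI T S w)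
      (use cover_program_correct[OF _ word] in \<open>simp only: T_def\<close>)
qed

end
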